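(* Let $f$ be a cookie-cutter mapping with $N\ge 2$ branches and cookie-cutter set $E$, and let $h\in(0,+\infty)$ be such that $Q(h)=0$. Then there exist a constant $\eta>1$ and a Borel probability measure $\mu_h$ supported by $E$ such that for every $\sigma\in\Omega$, $$\eta^{-1}|J_\sigma|^h\le\mu_h(J_\sigma)\le\eta\,|J_\sigma|^h .$$
   Context: Let $J=[0,1]$. A mapping $f$ is a cookie-cutter mapping if there are finitely many disjoint closed intervals $J_1,\dots,J_N\subset J$ such that: (C1) $f$ is defined in a neighborhood of each $J_j$, and the restriction $f|_{J_j}$ maps $J_j$ bijectively onto $J$; the branch inverse is $\varphi_j:=(f|_{J_j})^{-1}:J\to J_j$; (C2) $f$ is differentiable and there are $c>0$, $\gamma\in(0,1]$ with $|f'(x)-f'(y)|\le c|x-y|^\gamma$ for $x,y\in J_j$, $1\le j\le N$; (C3) $1<b:=\inf_x|f'(x)|\le\sup_x|f'(x)|=:B<+\infty$. Here $N\ge2$. $\Omega_n=\{1,\dots,N\}^n$ for $n\ge1$, $\Omega_0$ consists of the empty word, $\Omega=\bigcup_{k\ge0}\Omega_k$, $\Omega_\infty=\{1,\dots,N\}^{\mathbb N}$. For $\sigma=(\sigma_1,\dots,\sigma_n)\in\Omega_n$, $\varphi_\sigma=\varphi_{\sigma_1}\circ\cdots\circ\varphi_{\sigma_n}$ (identity on $J$ for the empty word), $J_\sigma=\varphi_\sigma(J)$, $|J_\sigma|$ is the diameter of $J_\sigma$, and $\|\varphi_\sigma'\|=\sup_{x\in J}|\varphi_\sigma'(x)|$.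 The cookie-cutter set is $E=\bigcup_{\sigma\in\Omega_\infty}\bigcap_{k\ge0}J_{\sigma|_k}$, where $\sigma|_k$ is the truncation of $\sigma$ to its first $k$ letters. For $t\in\mathbb R$, $Q(t)=\lim_{k\to\infty}\frac1k\log\sum_{\sigma\in\Omega_k}\|\varphi_\sigma'\|^t$ (the limit exists). *)

theory Defs
  imports "HOL-Probability.Probability_Measure"
begin

text \<open>
  \<open>f\<close> is a total function; only its germs along the intervals \<open>J 1, \<dots>, J N\<close> matter.
  Differentiability is two-sided at every point of each \<open>J j\<close>, endpoints included, which is
  where \<open>f\<close> being defined in a neighbourhood of \<open>J j\<close> is used. The infimum and the
  supremum of \<open>\<bar>f'\<bar>\<close> range over \<open>J 1 \<union> \<dots> \<union> J N\<close>.
\<close>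

definition cookie_cutter :: "nat \<Rightarrow> (nat \<Rightarrow> real set) \<Rightarrow> (real \<Rightarrow> real) \<Rightarrow> bool" where
  "cookie_cutter N J f \<longleftrightarrow>
     2 \<le> N \<and>
     (\<forall>j\<in>{1..N}. (\<exists>l u. l \<le> u \<and> J j = {l..u}) \<and> J j \<subseteq> {0..1}) \<and>
     disjoint_family_on J {1..N} \<and>
     (\<forall>j\<in>{1..N}. bij_betw f (J j) {0..1}) \<and>
     (\<forall>j\<in>{1..N}. \<forall>x\<in>J j. f differentiable (at x)) \<and>
     (\<exists>c>0. \<exists>\<gamma>\<in>{0<..1}. \<forall>j\<in>{1..N}. \<forall>x\<in>J j. \<forall>y\<in>J j.
        \<bar>deriv f x - deriv f y\<bar> \<le> c * \<bar>x - y\<bar> powr \<gamma>) \<and>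
     1 < (INF x\<in>(\<Union>j\<in>{1..N}. J j). \<bar>deriv f x\<bar>) \<and>
     bdd_above ((\<lambda>x. \<bar>deriv f x\<bar>) ` (\<Union>j\<in>{1..N}. J j))"

definition words :: "nat \<Rightarrow> nat \<Rightarrow> nat list set" where
  "words N n = {\<sigma>. length \<sigma> = n \<and> set \<sigma> \<subseteq> {1..N}}"

definition all_words :: "nat \<Rightarrow> nat list set" where
  "all_words N = (\<Union>n. words N n)"

definition infinite_words :: "nat \<Rightarrow> (nat \<Rightarrow> nat) set" where
  "infinite_words N = {\<sigma>. \<forall>i. \<sigma> i \<in> {1..N}}"

text \<open>The letters of an infinite word are indexed from 0.\<close>

definition truncation :: "(nat \<Rightarrow> nat) \<Rightarrow> nat \<Rightarrow> nat list" where
  "truncation \<sigma> k = map \<sigma> [0..<k]"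

definition branch :: "(nat \<Rightarrow> real set) \<Rightarrow> (real \<Rightarrow> real) \<Rightarrow> nat \<Rightarrow> real \<Rightarrow> real" where
  "branch J f j = the_inv_into (J j) f"

primrec word_branch :: "(nat \<Rightarrow> real set) \<Rightarrow> (real \<Rightarrow> real) \<Rightarrow> nat list \<Rightarrow> real \<Rightarrow> real" where
  "word_branch J f [] = id"
| "word_branch J f (j # \<sigma>) = branch J f j \<circ> word_branch J f \<sigma>"

definition cylinder :: "(nat \<Rightarrow> real set) \<Rightarrow> (real \<Rightarrow> real) \<Rightarrow> nat list \<Rightarrow> real set" where
  "cylinder J f \<sigma> = word_branch J f \<sigma> ` {0..1}"

text \<open>
  The inverse branches are meaningful only on \<open>[0,1]\<close>, so their derivatives are taken
  within \<open>[0,1]\<close>, i.e. one-sided at 0 and 1.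
\<close>

definition deriv_norm :: "(nat \<Rightarrow> real set) \<Rightarrow> (real \<Rightarrow> real) \<Rightarrow> nat list \<Rightarrow> real" where
  "deriv_norm J f \<sigma> =
     (SUP x\<in>{0..1}. \<bar>vector_derivative (word_branch J f \<sigma>) (at x within {0..1})\<bar>)"

definition cookie_cutter_set :: "nat \<Rightarrow> (nat \<Rightarrow> real set) \<Rightarrow> (real \<Rightarrow> real) \<Rightarrow> real set" where
  "cookie_cutter_set N J f =
     (\<Union>\<sigma>\<in>infinite_words N. \<Inter>k. cylinder J f (truncation \<sigma> k))"

definition pressure :: "nat \<Rightarrow> (nat \<Rightarrow> real set) \<Rightarrow> (real \<Rightarrow> real) \<Rightarrow> real \<Rightarrow> real" where
  "pressure N J f t =
     lim (\<lambda>k. 1 / real k * ln (\<Sum>\<sigma>\<in>words N k. deriv_norm J f \<sigma> powr t))"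

end

theory Submission
  imports Defs "HOL-Probability.Helly_Selection"
begin

text \<open>
  Write \<open>w \<sigma> = \<parallel>\<phi>\<^sub>\<sigma>'\<parallel>\<^sup>h\<close> and let \<open>Z n\<close> be the sum of \<open>w\<close> over the words of length \<open>n\<close>.

  Because \<open>f\<close> expands, \<open>\<phi>\<^sub>\<sigma>\<close> contracts exponentially in the length of \<open>\<sigma>\<close>, and since \<open>f'\<close> is
  Hoelder continuous, the factors by which \<open>\<phi>\<^sub>\<sigma>'\<close> varies along the orbit form a convergent
  product (\<open>bounded_distortion\<close>). Two consequences carry the proof. First, \<open>\<parallel>\<phi>\<^sub>\<sigma>'\<parallel>\<close> is
  comparable to the diameter of the cylinder of \<open>\<sigma>\<close> (\<open>diameter_cylinder\<close>), so it suffices to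
  find a measure giving that cylinder a mass comparable to \<open>w \<sigma>\<close>. Second, by the chain rule,
  \<open>w (\<sigma> @ \<tau>)\<close> is comparable to \<open>w \<sigma> * w \<tau>\<close>.

  The second fact makes \<open>ln (Z n)\<close> additive up to a bounded error, and such a sequence stays within
  a bounded distance of \<open>n\<close> times its growth rate (\<open>quasi_additive_linear\<close>). The growth rate is
  the pressure at \<open>h\<close>, which is zero, so \<open>Z n\<close> is bounded away from \<open>0\<close> and \<open>\<infinity>\<close>
  (\<open>partition_sum_bounds\<close>).

  Finally, let \<open>\<nu> n\<close> put mass \<open>w \<rho> / Z n\<close> on one point of the cylinder of each word \<open>\<rho>\<close> of length
  \<open>n\<close>. For a word \<open>\<sigma>\<close> of length \<open>m \<le> n\<close>, the \<open>\<nu> n\<close>-mass of its cylinder is comparable to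
  \<open>w \<sigma> * Z (n - m) / Z n\<close>, hence to \<open>w \<sigma>\<close>, with constants independent of \<open>n\<close>. Cylinders of the
  same length are disjoint compact sets, so both these bounds and the support condition survive in
  a weak limit of a subsequence (\<open>gibbs_measure_exists\<close>).
\<close>

section \<open>Words and sums over words\<close>

lemma words_append: "\<sigma> \<in> words N m \<Longrightarrow> \<tau> \<in> words N n \<Longrightarrow> \<sigma> @ \<tau> \<in> words N (m + n)"
  by (auto simp: words_def)

lemma finite_words [simp]: "finite (words N n)"
proof -
  have "words N n = {\<sigma>. set \<sigma> \<subseteq> {1..N} \<and> length \<sigma> = n}"
    by (auto simp: words_def)
  then show ?thesis
    by (simp add: finite_lists_length_eq)
qed

lemma words_nonempty:
  assumes "1 \<le> N" shows "words N n \<noteq> {}"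
proof -
  have "replicate n 1 \<in> words N n"
    using assms by (auto simp: words_def)
  then show ?thesis by blast
qed

lemma words_add: "words N (m + n) = (\<lambda>(\<sigma>, \<tau>). \<sigma> @ \<tau>) ` (words N m \<times> words N n)"
proof (intro equalityI subsetI)
  fix \<rho> assume \<rho>: "\<rho> \<in> words N (m + n)"
  have "set (take m \<rho>) \<subseteq> set \<rho>" "set (drop m \<rho>) \<subseteq> set \<rho>"
    by (rule set_take_subset, rule set_drop_subset)
  with \<rho> have "take m \<rho> \<in> words N m" "drop m \<rho> \<in> words N n"
    by (auto simp: words_def)
  moreover have "\<rho> = (\<lambda>(\<sigma>, \<tau>). \<sigma> @ \<tau>) (take m \<rho>, drop m \<rho>)"
    by simp
  ultimately show "\<rho> \<in> (\<lambda>(\<sigma>, \<tau>). \<sigma> @ \<tau>) ` (words N m \<times> words N n)"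
    by blast
qed (auto intro: words_append)

lemma sum_words_add:
  fixes F :: "nat list \<Rightarrow> real"
  shows "(\<Sum>\<rho>\<in>words N (m + n). F \<rho>) = (\<Sum>\<sigma>\<in>words N m. \<Sum>\<tau>\<in>words N n. F (\<sigma> @ \<tau>))"
proof -
  have inj: "inj_on (\<lambda>(\<sigma>, \<tau>). \<sigma> @ \<tau>) (words N m \<times> words N n)"
    by (auto simp: inj_on_def words_def)
  show ?thesis
    unfolding words_add sum.reindex[OF inj]
    by (simp add: sum.cartesian_product case_prod_unfold)
qed

section \<open>Quasi-additive sequences\<close>

text \<open>
  Comparing \<open>a (m * n)\<close> with both \<open>m * a n\<close> and \<open>n * a m\<close> gives
  \<open>\<bar>a m / m - a n / n\<bar> \<le> K / m + K / n\<close>. This makes \<open>a k / k\<close> a Cauchy sequence, and letting one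
  of the two indices tend to infinity yields the linear bound with the same constant \<open>K\<close>.
\<close>
lemma quasi_additive_linear:
  fixes a :: "nat \<Rightarrow> real"
  assumes qa: "\<And>m n. \<bar>a (m + n) - a m - a n\<bar> \<le> K"
  shows "\<exists>L. (\<lambda>k. 1 / real k * a k) \<longlonglongrightarrow> L \<and> (\<forall>k. \<bar>a k - real k * L\<bar> \<le> K)"
proof -
  have K0: "0 \<le> K" using qa[of 0 0] by linarith
  have mult: "\<bar>a (Suc m * k) - real (Suc m) * a k\<bar> \<le> real m * K" for m k
  proof (induction m)
    case (Suc m)
    have "\<bar>a (Suc m * k + k) - a (Suc m * k) - a k\<bar> \<le> K" by (rule qa)
    with Suc show ?case by (simp add: algebra_simps)
  qed simp
  have mult': "\<bar>a (m * k) - real m * a k\<bar> \<le> real m * K" if "0 < m" for m k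
  proof -
    have "\<bar>a (m * k) - real m * a k\<bar> \<le> real (m - 1) * K"
      using mult[of "m - 1" k] that by simp
    also have "\<dots> \<le> real m * K"
      using K0 by (intro mult_right_mono) auto
    finally show ?thesis .
  qed
  define q where "q k = 1 / real k * a k" for k
  have comp: "\<bar>q m - q k\<bar> \<le> K / real m + K / real k" if "0 < m" "0 < k" for m k
  proof -
    have "\<bar>real k * a m - real m * a k\<bar> \<le> real m * K + real k * K"
      using mult'[OF that(1), of k] mult'[OF that(2), of m] by (simp add: mult.commute)
    moreover have "q m - q k = (real k * a m - real m * a k) / (real m * real k)"
      using that by (simp add: q_def field_simps)
    moreover have "K / real m + K / real k = (real m * K + real k * K) / (real m * real k)"
      using that by (simp add: field_simps)
    ultimately show ?thesis
      using that by (simp add: abs_div divide_right_mono)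
  qed
  have "Cauchy q"
  proof (rule metric_CauchyI)
    fix e :: real assume "0 < e"
    obtain M :: nat where M: "2 * K / e < real M" using reals_Archimedean2 by blast
    have small: "K / real m < e / 2" if "Suc M \<le> m" for m
    proof -
      have "2 * K / e < real m" using M that by simp
      then show ?thesis using \<open>0 < e\<close> that by (simp add: field_simps)
    qed
    show "\<exists>M. \<forall>m\<ge>M. \<forall>n\<ge>M. dist (q m) (q n) < e"
    proof (intro exI allI impI)
      fix m n assume "Suc M \<le> m" "Suc M \<le> n"
      then show "dist (q m) (q n) < e"
        using comp[of m n] small[of m] small[of n] unfolding dist_real_def by linarith
    qed
  qed
  then obtain L where L: "q \<longlonglongrightarrow> L"
    using Cauchy_convergent convergent_def by blast
  have "\<bar>a k - real k * L\<bar> \<le> K" for k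
  proof (cases "k = 0")
    case True
    then show ?thesis using qa[of 0 0] by simp
  next
    case False
    have lim1: "(\<lambda>m. \<bar>q m - q k\<bar>) \<longlonglongrightarrow> \<bar>L - q k\<bar>"
      by (intro tendsto_intros L)
    have lim2: "(\<lambda>m. K / real m + K / real k) \<longlonglongrightarrow> 0 + K / real k"
      by (intro tendsto_intros lim_const_over_n)
    have "\<bar>L - q k\<bar> \<le> 0 + K / real k"
      using lim1 lim2
    proof (rule LIMSEQ_le)
      show "\<exists>M. \<forall>m\<ge>M. \<bar>q m - q k\<bar> \<le> K / real m + K / real k"
        using comp False by (intro exI[of _ 1]) auto
    qed
    then have "real k * \<bar>L - q k\<bar> \<le> K"
      using False by (simp add: field_simps)
    moreover have "a k - real k * L = - (real k * (L - q k))"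
      using False by (simp add: q_def field_simps)
    ultimately show ?thesis by (simp add: abs_mult)
  qed
  with L show ?thesis unfolding q_def by blast
qed

section \<open>Gibbs measures on trees of compact sets\<close>

locale compact_word_tree =
  fixes N :: nat and K :: "nat list \<Rightarrow> real set"
  assumes one_le_N: "1 \<le> N"
    and compact_node: "\<sigma> \<in> words N n \<Longrightarrow> compact (K \<sigma>)"
    and nonempty_node: "\<sigma> \<in> words N n \<Longrightarrow> K \<sigma> \<noteq> {}"
    and nested: "\<sigma> \<in> words N m \<Longrightarrow> \<tau> \<in> words N n \<Longrightarrow> K (\<sigma> @ \<tau>) \<subseteq> K \<sigma>"
    and disjoint_nodes: "\<sigma> \<in> words N n \<Longrightarrow> \<tau> \<in> words N n \<Longrightarrow> \<sigma> \<noteq> \<tau> \<Longrightarrow> K \<sigma> \<inter> K \<tau> = {}"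
begin

definition level :: "nat \<Rightarrow> real set" where
  "level n = (\<Union>\<sigma>\<in>words N n. K \<sigma>)"

lemma compact_level: "compact (level n)"
  unfolding level_def by (intro compact_UN) (auto intro: compact_node)

text \<open>
  A point lying in every level determines one word of each length by disjointness, and nesting
  makes these words prefixes of one another; they are the truncations of a single infinite word.
  Expressed through the compact levels, the limit set is visibly Borel.
\<close>
lemma limit_set_eq_Inter_level:
  "(\<Union>\<omega>\<in>infinite_words N. \<Inter>k. K (truncation \<omega> k)) = (\<Inter>n. level n)"
proof (intro equalityI subsetI)
  fix x assume "x \<in> (\<Union>\<omega>\<in>infinite_words N. \<Inter>k. K (truncation \<omega> k))"
  then obtain \<omega> where \<omega>: "\<omega> \<in> infinite_words N" "\<And>k. x \<in> K (truncation \<omega> k)"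
    by blast
  have "truncation \<omega> k \<in> words N k" for k
    using \<omega>(1) by (auto simp: truncation_def words_def infinite_words_def)
  with \<omega>(2) show "x \<in> (\<Inter>n. level n)"
    by (auto simp: level_def)
next
  fix x assume "x \<in> (\<Inter>n. level n)"
  then have "\<forall>n. \<exists>\<sigma>. \<sigma> \<in> words N n \<and> x \<in> K \<sigma>"
    by (auto simp: level_def)
  then obtain s where s: "\<And>n. s n \<in> words N n" "\<And>n. x \<in> K (s n)"
    by metis
  have take_s: "take n (s m) = s n" if "n \<le> m" for m n
  proof -
    from that obtain d where d: "m = n + d" using le_Suc_ex by blast
    have "s m \<in> words N (n + d)" using s(1)[of m] d by simp
    then obtain \<sigma> \<tau> where \<sigma>\<tau>: "\<sigma> \<in> words N n" "\<tau> \<in> words N d" "s m = \<sigma> @ \<tau>"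
      by (auto simp: words_add)
    have "x \<in> K \<sigma>" using nested[OF \<sigma>\<tau>(1,2)] s(2)[of m] \<sigma>\<tau>(3) by auto
    then have "\<sigma> = s n" using disjoint_nodes[OF \<sigma>\<tau>(1) s(1)[of n]] s(2)[of n] by blast
    then show ?thesis using \<sigma>\<tau> by (auto simp: words_def)
  qed
  define \<omega> where "\<omega> i = s (Suc i) ! i" for i
  have len: "length (s n) = n" for n using s(1)[of n] by (simp add: words_def)
  have "truncation \<omega> n = s n" for n
  proof (rule nth_equalityI)
    fix i assume "i < length (truncation \<omega> n)"
    then have i: "i < n" by (simp add: truncation_def)
    have "s (Suc i) ! i = take (Suc i) (s n) ! i" using take_s[of "Suc i" n] i by simp
    then show "truncation \<omega> n ! i = s n ! i" using i by (simp add: truncation_def \<omega>_def)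
  qed (simp add: truncation_def len)
  then have "x \<in> (\<Inter>k. K (truncation \<omega> k))" using s(2) by simp
  moreover have "\<omega> i \<in> {1..N}" for i
  proof -
    have "\<omega> i \<in> set (s (Suc i))" unfolding \<omega>_def by (rule nth_mem) (simp add: len)
    then show ?thesis using s(1)[of "Suc i"] by (auto simp: words_def)
  qed
  then have "\<omega> \<in> infinite_words N" by (simp add: infinite_words_def)
  ultimately show "x \<in> (\<Union>\<omega>\<in>infinite_words N. \<Inter>k. K (truncation \<omega> k))" by blast
qed

text \<open>
  Weak convergence only controls integrals of continuous functions. On a level, the indicator of
  one node is continuous, since the finitely many other nodes form a disjoint compact set.
\<close>
lemma separating_function:
  assumes \<sigma>: "\<sigma> \<in> words N m"
  obtains g :: "real \<Rightarrow> real" where "continuous_on UNIV g" "\<And>x. \<bar>g x\<bar> \<le> 1"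
    "\<And>x. x \<in> level m \<Longrightarrow> g x = indicator (K \<sigma>) x"
proof -
  define R where "R = (\<Union>\<tau>\<in>words N m - {\<sigma>}. K \<tau>)"
  have "closed R"
    unfolding R_def by (intro compact_imp_closed compact_UN) (auto intro: compact_node)
  moreover have "closed (K \<sigma>)" using \<sigma> by (intro compact_imp_closed compact_node)
  moreover have disj: "R \<inter> K \<sigma> = {}"
    unfolding R_def using disjoint_nodes[OF \<sigma>] by blast
  ultimately obtain g :: "real \<Rightarrow> real" where g: "continuous_on UNIV g"
    "\<And>x. g x \<in> closed_segment 0 1" "\<And>x. x \<in> R \<Longrightarrow> g x = 0" "\<And>x. x \<in> K \<sigma> \<Longrightarrow> g x = 1"
    using Urysohn[of R "K \<sigma>" 0 1] by metis
  have lev: "x \<in> K \<sigma> \<or> x \<in> R" if "x \<in> level m" for x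
    using that unfolding level_def R_def by auto
  show ?thesis
  proof
    show "\<bar>g x\<bar> \<le> 1" for x using g(2)[of x] by (auto simp: closed_segment_eq_real_ivl)
    show "g x = indicator (K \<sigma>) x" if "x \<in> level m" for x
      using lev[OF that] g(3)[of x] g(4)[of x] disj by (auto simp: indicator_def)
  qed (rule g)
qed

text \<open>
  The measure is a weak limit of discrete measures \<open>\<nu> n\<close> carried by the nodes of depth \<open>n\<close>. The
  exponent \<open>3\<close> collects one factor \<open>C\<close> from comparing \<open>w (\<sigma> @ \<tau>)\<close> with \<open>w \<sigma> * w \<tau>\<close> and one from
  each of the two sums in the ratio \<open>Z (n - m) / Z n\<close>.
\<close>
proposition gibbs_measure_exists:
  fixes w :: "nat list \<Rightarrow> real"
  assumes w_pos: "\<And>n \<sigma>. \<sigma> \<in> words N n \<Longrightarrow> 0 < w \<sigma>"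
    and upper: "\<And>m n \<sigma> \<tau>. \<sigma> \<in> words N m \<Longrightarrow> \<tau> \<in> words N n \<Longrightarrow> w (\<sigma> @ \<tau>) \<le> C * (w \<sigma> * w \<tau>)"
    and lower: "\<And>m n \<sigma> \<tau>. \<sigma> \<in> words N m \<Longrightarrow> \<tau> \<in> words N n \<Longrightarrow> w \<sigma> * w \<tau> \<le> C * w (\<sigma> @ \<tau>)"
    and Z_upper: "\<And>n. (\<Sum>\<sigma>\<in>words N n. w \<sigma>) \<le> C"
    and Z_lower: "\<And>n. 1 / C \<le> (\<Sum>\<sigma>\<in>words N n. w \<sigma>)"
    and C_pos: "0 < C"
  shows "\<exists>\<mu>. real_distribution \<mu> \<and> (\<forall>n. AE x in \<mu>. x \<in> level n) \<and>
           (\<forall>n. \<forall>\<sigma>\<in>words N n. w \<sigma> / C ^ 3 \<le> measure \<mu> (K \<sigma>) \<and> measure \<mu> (K \<sigma>) \<le> C ^ 3 * w \<sigma>)"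
proof -
  define Z where "Z n = (\<Sum>\<sigma>\<in>words N n. w \<sigma>)" for n
  have Z_pos: "0 < Z n" for n
    using Z_lower[of n] C_pos by (simp add: Z_def) (metis less_le_trans zero_less_divide_1_iff)
  have "\<forall>\<sigma>. \<exists>x. \<sigma> \<in> all_words N \<longrightarrow> x \<in> K \<sigma>"
    using nonempty_node by (auto simp: all_words_def)
  then obtain p where p: "\<And>n \<sigma>. \<sigma> \<in> words N n \<Longrightarrow> p \<sigma> \<in> K \<sigma>"
    by (metis UN_I UNIV_I all_words_def)
  define P where "P n = point_measure (words N n) (\<lambda>\<sigma>. w \<sigma> / Z n)" for n
  define \<nu> where "\<nu> n = distr (P n) borel p" for n
  have p_meas: "p \<in> measurable (P n) borel" for n
    by (simp add: P_def)
  have P_prob: "prob_space (P n)" for n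
  proof
    have "(\<Sum>\<sigma>\<in>words N n. w \<sigma> / Z n) = 1"
      using Z_pos[of n] by (simp add: Z_def flip: sum_divide_distrib)
    then show "emeasure (P n) (space (P n)) = 1"
      using Z_pos[of n] w_pos
      by (simp add: P_def space_point_measure emeasure_point_measure_finite sum_ennreal less_imp_le)
  qed
  have \<nu>_dist: "real_distribution (\<nu> n)" for n
    unfolding real_distribution_def real_distribution_axioms_def \<nu>_def
    using prob_space.prob_space_distr[OF P_prob p_meas] by simp
  have \<nu>_int: "integral\<^sup>L (\<nu> n) g = (\<Sum>\<sigma>\<in>words N n. w \<sigma> / Z n * g (p \<sigma>))"
    if "continuous_on UNIV g" for n and g :: "real \<Rightarrow> real"
  proof -
    have "g \<in> borel_measurable borel" using that by (rule borel_measurable_continuous_onI)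
    then have "integral\<^sup>L (\<nu> n) g = integral\<^sup>L (P n) (\<lambda>\<sigma>. g (p \<sigma>))"
      unfolding \<nu>_def by (intro integral_distr p_meas)
    also have "\<dots> = (\<Sum>\<sigma>\<in>words N n. w \<sigma> / Z n * g (p \<sigma>))"
      unfolding P_def using Z_pos[of n] w_pos
      by (subst lebesgue_integral_point_measure_finite) (auto simp: less_imp_le)
    finally show ?thesis .
  qed
  \<comment> \<open>All the measures live on the compact root of the tree.\<close>
  have tight_\<nu>: "tight \<nu>"
  proof -
    have nil: "[] \<in> words N 0" by (simp add: words_def)
    obtain a where a: "\<And>x. x \<in> K [] \<Longrightarrow> \<bar>x\<bar> \<le> a"
      using compact_imp_bounded[OF compact_node[OF nil]] by (auto simp: bounded_iff)
    have "measure (\<nu> n) {- \<bar>a\<bar> - 1 <.. \<bar>a\<bar>} = 1" for n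
    proof -
      interpret \<nu>: real_distribution "\<nu> n" by (rule \<nu>_dist)
      have "p \<sigma> \<in> K []" if "\<sigma> \<in> words N n" for \<sigma>
        using p[OF that] nested[OF nil that] by auto
      then have bd: "\<bar>p \<sigma>\<bar> \<le> a" if "\<sigma> \<in> words N n" for \<sigma> using a that by blast
      have "AE \<sigma> in P n. p \<sigma> \<in> {- \<bar>a\<bar> - 1 <.. \<bar>a\<bar>}"
        unfolding P_def AE_point_measure by (fastforce dest: bd)
      then have "AE x in \<nu> n. x \<in> {- \<bar>a\<bar> - 1 <.. \<bar>a\<bar>}"
        unfolding \<nu>_def by (subst AE_distr_iff[OF p_meas]) auto
      then show ?thesis by (subst \<nu>.prob_eq_1) auto
    qed
    moreover have "- \<bar>a\<bar> - 1 < \<bar>a\<bar>" by simp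
    ultimately show ?thesis
      unfolding tight_def using \<nu>_dist by (metis diff_less_eq less_add_same_cancel1)
  qed
  obtain r \<mu> where r: "strict_mono (r :: nat \<Rightarrow> nat)" and \<mu>: "real_distribution \<mu>"
    and conv: "weak_conv_m (\<nu> \<circ> r) \<mu>"
    using tight_imp_convergent_subsubsequence[OF tight_\<nu> strict_mono_id] by auto
  interpret \<mu>: real_distribution \<mu> by (rule \<mu>)
  have int_conv: "(\<lambda>n. integral\<^sup>L (\<nu> (r n)) g) \<longlonglongrightarrow> integral\<^sup>L \<mu> g"
    if "continuous_on UNIV g" "\<And>x. \<bar>g x\<bar> \<le> 1" for g :: "real \<Rightarrow> real"
  proof -
    have "(\<lambda>n. integral\<^sup>L ((\<nu> \<circ> r) n) g) \<longlonglongrightarrow> integral\<^sup>L \<mu> g"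
      by (rule weak_conv_imp_integral_bdd_continuous_conv[where B = 1])
        (use that \<nu>_dist \<mu> conv in \<open>auto simp: continuous_on_eq_continuous_at comp_def\<close>)
    then show ?thesis by simp
  qed
  have r_ge: "\<forall>\<^sub>F n in sequentially. m \<le> r n" for m
    using filterlim_subseq[OF r] by (simp add: filterlim_at_top)
  have split: "\<exists>\<sigma>\<in>words N m. \<exists>\<tau>\<in>words N (n - m). \<rho> = \<sigma> @ \<tau>"
    if "\<rho> \<in> words N n" "m \<le> n" for \<rho> m n
    using that words_add[of N m "n - m"] by auto
  have p_level: "p \<rho> \<in> level m" if "\<rho> \<in> words N n" "m \<le> n" for \<rho> m n
    using split[OF that] nested p[OF that(1)] unfolding level_def by blast
  \<comment> \<open>The truncated distance to a level is a continuous test function that vanishes \<open>\<nu> n\<close>-almost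
    everywhere once \<open>n \<ge> m\<close>; its integral against the limit is therefore \<open>0\<close>.\<close>
  have AE_level: "AE x in \<mu>. x \<in> level m" for m
  proof -
    define g where "g x = min 1 (infdist x (level m))" for x
    have cont: "continuous_on UNIV g"
      unfolding g_def by (intro continuous_intros)
    have g_bd: "0 \<le> g x" "\<bar>g x\<bar> \<le> 1" for x by (auto simp: g_def infdist_nonneg)
    have "integral\<^sup>L (\<nu> n) g = 0" if "m \<le> n" for n
      unfolding \<nu>_int[OF cont]
      by (rule sum.neutral) (use p_level that in \<open>auto simp: g_def\<close>)
    then have "\<forall>\<^sub>F n in sequentially. integral\<^sup>L (\<nu> (r n)) g = 0"
      using r_ge[of m] by (auto elim: eventually_mono)
    then have "integral\<^sup>L \<mu> g = 0"
      using int_conv[OF cont g_bd(2)] by (metis LIMSEQ_unique tendsto_eventually)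
    moreover have "integrable \<mu> g"
      using borel_measurable_continuous_onI[OF cont] g_bd(2)
      by (intro \<mu>.integrable_const_bound[where B = 1]) auto
    ultimately have "AE x in \<mu>. g x = 0"
      using integral_nonneg_eq_0_iff_AE[of \<mu> g] g_bd(1) by simp
    moreover have "x \<in> level m" if "g x = 0" for x
    proof -
      have "infdist x (level m) = 0" using that by (auto simp: g_def min_def split: if_splits)
      moreover have "level m \<noteq> {}"
        using words_nonempty[OF one_le_N, of m] nonempty_node unfolding level_def by blast
      ultimately show ?thesis
        using in_closed_iff_infdist_zero[OF compact_imp_closed[OF compact_level]] by blast
    qed
    ultimately show ?thesis by (auto elim: eventually_mono)
  qed
  have bounds: "w \<sigma> / C ^ 3 \<le> measure \<mu> (K \<sigma>) \<and> measure \<mu> (K \<sigma>) \<le> C ^ 3 * w \<sigma>"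
    if \<sigma>: "\<sigma> \<in> words N m" for m \<sigma>
  proof -
    obtain g :: "real \<Rightarrow> real" where g: "continuous_on UNIV g" "\<And>x. \<bar>g x\<bar> \<le> 1"
      "\<And>x. x \<in> level m \<Longrightarrow> g x = indicator (K \<sigma>) x"
      using separating_function[OF \<sigma>] by metis
    have K_sets: "K \<sigma> \<in> sets \<mu>"
      using compact_node[OF \<sigma>] by (simp add: borel_compact)
    have "integral\<^sup>L \<mu> g = integral\<^sup>L \<mu> (indicator (K \<sigma>))"
      using borel_measurable_continuous_onI[OF g(1)] K_sets
      by (intro integral_cong_AE eventually_mono[OF AE_level[of m]]) (auto simp: g(3))
    also have "\<dots> = measure \<mu> (K \<sigma>)"
      using K_sets by simp
    finally have lim: "(\<lambda>n. integral\<^sup>L (\<nu> (r n)) g) \<longlonglongrightarrow> measure \<mu> (K \<sigma>)"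
      using int_conv[OF g(1,2)] by simp
    have fin: "w \<sigma> / C ^ 3 \<le> integral\<^sup>L (\<nu> n) g \<and> integral\<^sup>L (\<nu> n) g \<le> C ^ 3 * w \<sigma>"
      if "m \<le> n" for n
    proof -
      from that obtain d where d: "n = m + d" using le_Suc_ex by blast
      have gp: "g (p (\<sigma>' @ \<tau>)) = of_bool (\<sigma>' = \<sigma>)"
        if "\<sigma>' \<in> words N m" "\<tau> \<in> words N d" for \<sigma>' \<tau>
      proof -
        have "p (\<sigma>' @ \<tau>) \<in> K \<sigma>'"
          using p[OF words_append[OF that]] nested[OF that] by blast
        then have "p (\<sigma>' @ \<tau>) \<in> level m" "p (\<sigma>' @ \<tau>) \<in> K \<sigma> \<longleftrightarrow> \<sigma>' = \<sigma>"
          using disjoint_nodes[OF that(1) \<sigma>] that(1) by (auto simp: level_def)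
        then show ?thesis
          using g(3) by (simp add: indicator_def)
      qed
      have "integral\<^sup>L (\<nu> n) g
          = (\<Sum>\<sigma>'\<in>words N m. \<Sum>\<tau>\<in>words N d. w (\<sigma>' @ \<tau>) / Z n * of_bool (\<sigma>' = \<sigma>))"
        unfolding \<nu>_int[OF g(1)] d sum_words_add by (intro sum.cong) (auto simp: gp)
      also have "\<dots> = (\<Sum>\<sigma>'\<in>words N m. if \<sigma>' = \<sigma> then \<Sum>\<tau>\<in>words N d. w (\<sigma>' @ \<tau>) / Z n else 0)"
        by (intro sum.cong) auto
      also have "\<dots> = (\<Sum>\<tau>\<in>words N d. w (\<sigma> @ \<tau>)) / Z n"
        using \<sigma> by (simp add: sum_divide_distrib)
      finally have eq: "integral\<^sup>L (\<nu> n) g = (\<Sum>\<tau>\<in>words N d. w (\<sigma> @ \<tau>)) / Z n" .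
      have w\<sigma>: "0 < w \<sigma>" using w_pos[OF \<sigma>] .
      have Zb: "Z k \<le> C" "1 \<le> C * Z k" for k
        using Z_upper[of k] Z_lower[of k] C_pos by (auto simp: Z_def field_simps)
      have "(\<Sum>\<tau>\<in>words N d. w (\<sigma> @ \<tau>)) \<le> (\<Sum>\<tau>\<in>words N d. C * (w \<sigma> * w \<tau>))"
        using upper[OF \<sigma>] by (intro sum_mono) auto
      also have "\<dots> = C * w \<sigma> * Z d"
        by (simp add: Z_def sum_distrib_left mult.assoc)
      also have "\<dots> \<le> C * w \<sigma> * C"
        using Zb(1)[of d] C_pos w\<sigma> by (intro mult_left_mono) auto
      also have "\<dots> \<le> C * w \<sigma> * C * (C * Z n)"
        using mult_left_mono[OF Zb(2)[of n], of "C * w \<sigma> * C"] C_pos w\<sigma> by simp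
      finally have up: "integral\<^sup>L (\<nu> n) g \<le> C ^ 3 * w \<sigma>"
        unfolding eq using Z_pos[of n] by (simp add: field_simps power3_eq_cube)
      have "w \<sigma> * Z d = (\<Sum>\<tau>\<in>words N d. w \<sigma> * w \<tau>)"
        by (simp add: Z_def sum_distrib_left)
      also have "\<dots> \<le> (\<Sum>\<tau>\<in>words N d. C * w (\<sigma> @ \<tau>))"
        using lower[OF \<sigma>] by (intro sum_mono) auto
      finally have low1: "w \<sigma> * Z d \<le> C * (\<Sum>\<tau>\<in>words N d. w (\<sigma> @ \<tau>))"
        by (simp add: sum_distrib_left)
      have "w \<sigma> * Z n \<le> w \<sigma> * C"
        using Zb(1)[of n] w\<sigma> by (intro mult_left_mono) auto
      also have "\<dots> \<le> w \<sigma> * C * (C * Z d)"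
        using mult_left_mono[OF Zb(2)[of d], of "w \<sigma> * C"] C_pos w\<sigma> by simp
      also have "\<dots> = C * C * (w \<sigma> * Z d)" by simp
      also have "\<dots> \<le> C * C * (C * (\<Sum>\<tau>\<in>words N d. w (\<sigma> @ \<tau>)))"
        using low1 C_pos by (intro mult_left_mono) auto
      finally have "w \<sigma> / C ^ 3 \<le> integral\<^sup>L (\<nu> n) g"
        unfolding eq using Z_pos[of n] C_pos by (simp add: field_simps power3_eq_cube)
      with up show ?thesis by simp
    qed
    have ev: "\<forall>\<^sub>F n in sequentially. w \<sigma> / C ^ 3 \<le> integral\<^sup>L (\<nu> (r n)) g"
      "\<forall>\<^sub>F n in sequentially. integral\<^sup>L (\<nu> (r n)) g \<le> C ^ 3 * w \<sigma>"
      using r_ge[of m] fin by (auto elim: eventually_mono)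
    show ?thesis
      using tendsto_lowerbound[OF lim ev(1)] tendsto_upperbound[OF lim ev(2)] by simp
  qed
  show ?thesis
    using \<mu> AE_level bounds by blast
qed

end

section \<open>Bounded distortion\<close>

text \<open>
  The derivative of \<open>word_branch J f \<sigma>\<close> read off from the chain rule: each letter contributes the reciprocal of \<open>f'\<close> at the
  point reached so far. Stating it as a recursion makes distortion estimates inductions on words.
\<close>
primrec word_deriv :: "(nat \<Rightarrow> real set) \<Rightarrow> (real \<Rightarrow> real) \<Rightarrow> nat list \<Rightarrow> real \<Rightarrow> real" where
  "word_deriv J f [] x = 1"
| "word_deriv J f (j # \<sigma>) x = word_deriv J f \<sigma> x / deriv f (word_branch J f (j # \<sigma>) x)"

lemma word_branch_append: "word_branch J f (\<sigma> @ \<tau>) = word_branch J f \<sigma> \<circ> word_branch J f \<tau>"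
  by (induction \<sigma>) (auto simp: fun_eq_iff)

lemma word_deriv_append:
  "word_deriv J f (\<sigma> @ \<tau>) x = word_deriv J f \<sigma> (word_branch J f \<tau> x) * word_deriv J f \<tau> x"
  by (induction \<sigma>) (auto simp: word_branch_append)

text \<open>
  The constants of the Hoelder and expansion conditions are parameters here, so that the distortion
  bound can be written explicitly in terms of them.
\<close>
locale cookie_cutter_map =
  fixes N :: nat and J :: "nat \<Rightarrow> real set" and f :: "real \<Rightarrow> real" and c \<gamma> b :: real
  assumes two_le_N: "2 \<le> N"
    and compact_J: "j \<in> {1..N} \<Longrightarrow> compact (J j)"
    and J_subset: "j \<in> {1..N} \<Longrightarrow> J j \<subseteq> {0..1}"
    and disjoint_J: "disjoint_family_on J {1..N}"
    and bij_f: "j \<in> {1..N} \<Longrightarrow> bij_betw f (J j) {0..1}"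
    and diff_f: "j \<in> {1..N} \<Longrightarrow> x \<in> J j \<Longrightarrow> f differentiable (at x)"
    and c_pos: "0 < c" and \<gamma>_pos: "0 < \<gamma>"
    and holder: "j \<in> {1..N} \<Longrightarrow> x \<in> J j \<Longrightarrow> y \<in> J j \<Longrightarrow>
                   \<bar>deriv f x - deriv f y\<bar> \<le> c * \<bar>x - y\<bar> powr \<gamma>"
    and b_gt_1: "1 < b"
    and expanding: "j \<in> {1..N} \<Longrightarrow> x \<in> J j \<Longrightarrow> b \<le> \<bar>deriv f x\<bar>"

lemma cookie_cutter_imp_map:
  assumes "cookie_cutter N J f"
  obtains c \<gamma> b where "cookie_cutter_map N J f c \<gamma> b"
proof -
  let ?U = "\<Union>j\<in>{1..N}. J j"
  define b where "b = (INF x\<in>?U. \<bar>deriv f x\<bar>)"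
  from assms obtain c \<gamma> where c: "0 < c" "0 < \<gamma>"
    "\<forall>j\<in>{1..N}. \<forall>x\<in>J j. \<forall>y\<in>J j. \<bar>deriv f x - deriv f y\<bar> \<le> c * \<bar>x - y\<bar> powr \<gamma>"
    unfolding cookie_cutter_def by auto
  have exp: "b \<le> \<bar>deriv f x\<bar>" if "j \<in> {1..N}" "x \<in> J j" for j x
    unfolding b_def using that by (intro cINF_lower bdd_belowI[of _ 0]) auto
  have comp: "compact (J j)" if "j \<in> {1..N}" for j
    using assms that unfolding cookie_cutter_def by (metis compact_Icc)
  have "cookie_cutter_map N J f c \<gamma> b"
    using assms c exp comp unfolding cookie_cutter_map_def cookie_cutter_def b_def by simp
  then show ?thesis by (rule that)
qed

context cookie_cutter_map
begin

abbreviation "\<phi> \<equiv> word_branch J f"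
abbreviation "D \<equiv> word_deriv J f"

lemma branch_in: "j \<in> {1..N} \<Longrightarrow> x \<in> {0..1} \<Longrightarrow> branch J f j x \<in> J j"
  unfolding branch_def using bij_f[of j] by (intro the_inv_into_into) (auto simp: bij_betw_def)

lemma inj_branch: "j \<in> {1..N} \<Longrightarrow> inj_on (branch J f j) {0..1}"
  unfolding branch_def using bij_betw_the_inv_into[OF bij_f] by (auto simp: bij_betw_def)

lemma branch_derivative:
  assumes j: "j \<in> {1..N}" and x: "x \<in> {0..1}"
  shows "(branch J f j has_real_derivative 1 / deriv f (branch J f j x)) (at x within {0..1})"
proof -
  let ?g = "branch J f j"
  have im: "f ` J j = {0..1}" and inj: "inj_on f (J j)"
    using bij_f[OF j] by (auto simp: bij_betw_def)
  have gx: "?g x \<in> J j" using branch_in[OF j x] .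
  have fg: "f (?g x) = x"
    unfolding branch_def using f_the_inv_into_f[OF inj] x im by blast
  have gf: "?g (f y) = y" if "y \<in> J j" for y
    unfolding branch_def using the_inv_into_f_f[OF inj that] .
  have der: "(f has_real_derivative deriv f y) (at y)" if "y \<in> J j" for y
    using diff_f[OF j that]
    by (simp add: DERIV_deriv_iff_real_differentiable)
  have nz: "deriv f (?g x) \<noteq> 0" using expanding[OF j gx] b_gt_1 by auto
  have "continuous_on (J j) f"
    by (intro continuous_at_imp_continuous_on ballI) (use der DERIV_isCont in blast)
  then have "continuous_on {0..1} ?g"
    using continuous_on_inv[OF _ compact_J[OF j], of f ?g] gf im by auto
  then have cont: "continuous (at (f (?g x)) within f ` J j) ?g"
    using x by (simp add: im fg continuous_on_eq_continuous_within)
  have "(?g has_derivative (*) (1 / deriv f (?g x))) (at (f (?g x)) within f ` J j)"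
  proof (rule has_derivative_inverse_within[OF _ cont gx])
    show "(f has_derivative (*) (deriv f (?g x))) (at (?g x) within J j)"
      using der[OF gx] has_derivative_at_withinI unfolding has_field_derivative_def by blast
    show "linear ((*) (1 / deriv f (?g x)))"
      by (intro bounded_linear.linear bounded_linear_mult_right)
  qed (use nz gf in \<open>auto simp: fun_eq_iff\<close>)
  then show ?thesis by (simp add: has_field_derivative_def im fg)
qed

lemma word_branch_in: "\<sigma> \<in> words N n \<Longrightarrow> x \<in> {0..1} \<Longrightarrow> \<phi> \<sigma> x \<in> {0..1}"
proof (induction \<sigma> arbitrary: n)
  case (Cons j \<sigma>)
  then have j: "j \<in> {1..N}" and \<sigma>: "\<sigma> \<in> words N (length \<sigma>)" by (auto simp: words_def)
  show ?case using branch_in[OF j Cons.IH[OF \<sigma> Cons.prems(2)]] J_subset[OF j] by auto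
qed simp

lemma word_branch_Cons_in:
  "j # \<sigma> \<in> words N n \<Longrightarrow> x \<in> {0..1} \<Longrightarrow> \<phi> (j # \<sigma>) x \<in> J j"
  using word_branch_in[of \<sigma> "length \<sigma>" x] branch_in[of j "\<phi> \<sigma> x"] by (auto simp: words_def)

lemma word_branch_derivative:
  "\<sigma> \<in> words N n \<Longrightarrow> x \<in> {0..1} \<Longrightarrow> (\<phi> \<sigma> has_real_derivative D \<sigma> x) (at x within {0..1})"
proof (induction \<sigma> arbitrary: n)
  case Nil
  show ?case using DERIV_ident[of "at x within {0..1}"] by (simp add: id_def)
next
  case (Cons j \<sigma>)
  then have j: "j \<in> {1..N}" and \<sigma>: "\<sigma> \<in> words N (length \<sigma>)" by (auto simp: words_def)
  have im: "\<phi> \<sigma> ` {0..1} \<subseteq> {0..1}" using word_branch_in[OF \<sigma>] by blast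
  have "(branch J f j has_real_derivative 1 / deriv f (branch J f j (\<phi> \<sigma> x)))
          (at (\<phi> \<sigma> x) within \<phi> \<sigma> ` {0..1})"
    using branch_derivative[OF j word_branch_in[OF \<sigma> Cons.prems(2)]] im
    by (rule DERIV_subset)
  from DERIV_image_chain[OF this Cons.IH[OF \<sigma> Cons.prems(2)]]
  show ?case by (simp add: mult.commute comp_def)
qed

lemma word_deriv_le: "\<sigma> \<in> words N n \<Longrightarrow> x \<in> {0..1} \<Longrightarrow> \<bar>D \<sigma> x\<bar> \<le> (1 / b) ^ n"
proof (induction \<sigma> arbitrary: n)
  case (Cons j \<sigma>)
  then obtain m where n: "n = Suc m" and j: "j \<in> {1..N}" and \<sigma>: "\<sigma> \<in> words N m"
    by (auto simp: words_def)
  have "\<bar>D (j # \<sigma>) x\<bar> = \<bar>D \<sigma> x\<bar> / \<bar>deriv f (\<phi> (j # \<sigma>) x)\<bar>" by (simp add: abs_div)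
  also have "\<dots> \<le> (1 / b) ^ m / b"
    using Cons.IH[OF \<sigma> Cons.prems(2)] expanding[OF j word_branch_Cons_in[OF Cons.prems]] b_gt_1
    by (intro frac_le) auto
  finally show ?case by (simp add: n)
qed (simp add: words_def)

lemma word_deriv_nonzero: "\<sigma> \<in> words N n \<Longrightarrow> x \<in> {0..1} \<Longrightarrow> D \<sigma> x \<noteq> 0"
proof (induction \<sigma> arbitrary: n)
  case (Cons j \<sigma>)
  then have j: "j \<in> {1..N}" and \<sigma>: "\<sigma> \<in> words N (length \<sigma>)" by (auto simp: words_def)
  show ?case
    using Cons.IH[OF \<sigma> Cons.prems(2)] expanding[OF j word_branch_Cons_in[OF Cons.prems]] b_gt_1
    by auto
qed simp

lemma word_branch_lipschitz:
  assumes "\<sigma> \<in> words N n" "x \<in> {0..1}" "y \<in> {0..1}" "\<And>z. z \<in> {0..1} \<Longrightarrow> \<bar>D \<sigma> z\<bar> \<le> B"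
  shows "\<bar>\<phi> \<sigma> x - \<phi> \<sigma> y\<bar> \<le> B * \<bar>x - y\<bar>"
proof -
  have "norm (\<phi> \<sigma> x - \<phi> \<sigma> y) \<le> B * norm (x - y)"
    by (rule field_differentiable_bound[of "{0..1}" _ "D \<sigma>"])
      (use assms word_branch_derivative[OF assms(1)] in auto)
  then show ?thesis by simp
qed

text \<open>
  The exponent is \<open>c\<close> times the geometric series with ratio \<open>b powr - \<gamma>\<close>: two points of \<open>[0,1]\<close>
  come within \<open>b powr - n\<close> of each other after \<open>n\<close> inverse branches, and \<open>f'\<close> then differs by at
  most \<open>c\<close> times the \<open>n\<close>-th power of this ratio.
\<close>
definition distortion :: real where
  "distortion = exp (c / (1 - (1 / b) powr \<gamma>))"

lemma ratio_lt_1: "(1 / b) powr \<gamma> < 1"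
  using b_gt_1 \<gamma>_pos powr_less_mono2[of \<gamma> "1 / b" 1] by simp

lemma distortion_ge_1: "1 \<le> distortion"
  unfolding distortion_def using ratio_lt_1 c_pos by simp

text \<open>
  Prepending a letter to a word of length \<open>m\<close> multiplies the ratio of the derivatives at \<open>x\<close> and
  \<open>y\<close> by \<open>f' v / f' u\<close>, where \<open>u\<close> and \<open>v\<close> are exponentially close images of \<open>x\<close> and \<open>y\<close>. As
  \<open>\<bar>f'\<bar> \<ge> 1\<close>, this factor is at most \<open>1\<close> plus the Hoelder bound, hence at most the exponential of
  that bound, and the exponents add up to a convergent series.
\<close>
lemma bounded_distortion:
  assumes "\<sigma> \<in> words N n" "x \<in> {0..1}" "y \<in> {0..1}"
  shows "\<bar>D \<sigma> x\<bar> \<le> distortion * \<bar>D \<sigma> y\<bar>"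
proof -
  let ?r = "(1 / b) powr \<gamma>"
  have r: "0 < ?r" "?r < 1" using b_gt_1 ratio_lt_1 by auto
  have "\<bar>D \<sigma> x\<bar> \<le> exp (c * (\<Sum>k<n. ?r ^ k)) * \<bar>D \<sigma> y\<bar>"
    using assms
  proof (induction \<sigma> arbitrary: n)
    case Nil
    then show ?case by (simp add: words_def)
  next
    case (Cons j \<sigma>)
    then obtain m where n: "n = Suc m" and j: "j \<in> {1..N}" and \<sigma>: "\<sigma> \<in> words N m"
      by (auto simp: words_def)
    let ?u = "\<phi> (j # \<sigma>) x" and ?v = "\<phi> (j # \<sigma>) y"
    have uv: "?u \<in> J j" "?v \<in> J j"
      using word_branch_Cons_in Cons.prems by blast+
    have "\<bar>?u - ?v\<bar> \<le> (1 / b) ^ n * \<bar>x - y\<bar>"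
      using Cons.prems word_deriv_le[OF Cons.prems(1)] by (intro word_branch_lipschitz) auto
    also have "\<dots> \<le> (1 / b) ^ n * 1"
      using b_gt_1 Cons.prems by (intro mult_left_mono) auto
    also have "\<dots> \<le> (1 / b) ^ m"
      using b_gt_1 by (simp add: n field_simps)
    finally have "\<bar>?u - ?v\<bar> powr \<gamma> \<le> ((1 / b) ^ m) powr \<gamma>"
      using \<gamma>_pos by (intro powr_mono2) auto
    also have "\<dots> = ?r ^ m"
      using b_gt_1 by (simp add: powr_power powr_powr mult.commute flip: powr_realpow)
    finally have close: "c * \<bar>?u - ?v\<bar> powr \<gamma> \<le> c * ?r ^ m"
      using c_pos by simp
    have du: "1 \<le> \<bar>deriv f ?u\<bar>" and dv: "1 \<le> \<bar>deriv f ?v\<bar>"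
      using expanding[OF j] uv b_gt_1 by force+
    have "\<bar>deriv f ?v\<bar> \<le> \<bar>deriv f ?u\<bar> + c * ?r ^ m"
      using holder[OF j uv] close by linarith
    also have "\<dots> \<le> \<bar>deriv f ?u\<bar> + c * ?r ^ m * \<bar>deriv f ?u\<bar>"
      using mult_left_mono[OF du, of "c * ?r ^ m"] c_pos by simp
    also have "\<dots> = (1 + c * ?r ^ m) * \<bar>deriv f ?u\<bar>"
      by (simp add: algebra_simps)
    also have "\<dots> \<le> exp (c * ?r ^ m) * \<bar>deriv f ?u\<bar>"
      by (intro mult_right_mono exp_ge_add_one_self) auto
    finally have ratio: "1 / \<bar>deriv f ?u\<bar> \<le> exp (c * ?r ^ m) / \<bar>deriv f ?v\<bar>"
      using du dv by (simp add: field_simps)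
    have "\<bar>D (j # \<sigma>) x\<bar> = \<bar>D \<sigma> x\<bar> * (1 / \<bar>deriv f ?u\<bar>)"
      by (simp add: abs_div)
    also have "\<dots> \<le> (exp (c * (\<Sum>k<m. ?r ^ k)) * \<bar>D \<sigma> y\<bar>) * (exp (c * ?r ^ m) / \<bar>deriv f ?v\<bar>)"
      using Cons.IH[OF \<sigma>] Cons.prems ratio by (intro mult_mono) auto
    also have "\<dots> = exp (c * (\<Sum>k<n. ?r ^ k)) * \<bar>D (j # \<sigma>) y\<bar>"
      by (simp add: n abs_div exp_add distrib_left)
    finally show ?case .
  qed
  also have "\<dots> \<le> distortion * \<bar>D \<sigma> y\<bar>"
  proof (intro mult_right_mono)
    have "(\<Sum>k<n. ?r ^ k) \<le> (\<Sum>k. ?r ^ k)"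
      using r by (intro sum_le_suminf summable_geometric) auto
    also have "\<dots> = 1 / (1 - ?r)"
      using r by (intro suminf_geometric) auto
    finally show "exp (c * (\<Sum>k<n. ?r ^ k)) \<le> distortion"
      using mult_left_mono[of _ _ c] c_pos unfolding distortion_def by fastforce
  qed simp
  finally show ?thesis .
qed

lemma deriv_norm_eq: "\<sigma> \<in> words N n \<Longrightarrow> deriv_norm J f \<sigma> = (SUP x\<in>{0..1}. \<bar>D \<sigma> x\<bar>)"
  unfolding deriv_norm_def
  by (intro arg_cong[where f = Sup] image_cong refl arg_cong[where f = abs]
      vector_derivative_within_closed_interval)
    (use word_branch_derivative in \<open>auto simp: has_real_derivative_iff_has_vector_derivative\<close>)

lemma deriv_norm_upper:
  assumes "\<sigma> \<in> words N n" "x \<in> {0..1}"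
  shows "\<bar>D \<sigma> x\<bar> \<le> deriv_norm J f \<sigma>"
  unfolding deriv_norm_eq[OF assms(1)]
  using word_deriv_le[OF assms(1)] assms(2) by (intro cSUP_upper bdd_aboveI2) auto

lemma deriv_norm_le:
  assumes "\<sigma> \<in> words N n" "\<And>x. x \<in> {0..1} \<Longrightarrow> \<bar>D \<sigma> x\<bar> \<le> B"
  shows "deriv_norm J f \<sigma> \<le> B"
  unfolding deriv_norm_eq[OF assms(1)] using assms(2) by (intro cSUP_least) auto

lemma deriv_norm_distortion:
  assumes "\<sigma> \<in> words N n" "x \<in> {0..1}"
  shows "deriv_norm J f \<sigma> \<le> distortion * \<bar>D \<sigma> x\<bar>"
  using bounded_distortion[OF assms(1) _ assms(2)] by (intro deriv_norm_le[OF assms(1)])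

lemma deriv_norm_pos: "\<sigma> \<in> words N n \<Longrightarrow> 0 < deriv_norm J f \<sigma>"
  using deriv_norm_upper[of \<sigma> n 0] word_deriv_nonzero[of \<sigma> n 0] by fastforce

lemma deriv_norm_append_le:
  assumes \<sigma>: "\<sigma> \<in> words N m" and \<tau>: "\<tau> \<in> words N n"
  shows "deriv_norm J f (\<sigma> @ \<tau>) \<le> deriv_norm J f \<sigma> * deriv_norm J f \<tau>"
proof (rule deriv_norm_le[OF words_append[OF \<sigma> \<tau>]])
  fix x :: real assume x: "x \<in> {0..1}"
  show "\<bar>D (\<sigma> @ \<tau>) x\<bar> \<le> deriv_norm J f \<sigma> * deriv_norm J f \<tau>"
    unfolding word_deriv_append abs_mult
    using deriv_norm_upper[OF \<sigma> word_branch_in[OF \<tau> x]] deriv_norm_upper[OF \<tau> x]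
      deriv_norm_pos[OF \<sigma>] by (intro mult_mono) auto
qed

text \<open>
  The suprema for \<open>\<sigma>\<close> and \<open>\<tau>\<close> may be attained at unrelated points. Moving both to the orbit of
  \<open>0\<close>, where the chain rule is an equality, costs one distortion factor each.
\<close>
lemma deriv_norm_append_ge:
  assumes \<sigma>: "\<sigma> \<in> words N m" and \<tau>: "\<tau> \<in> words N n"
  shows "deriv_norm J f \<sigma> * deriv_norm J f \<tau> \<le> distortion\<^sup>2 * deriv_norm J f (\<sigma> @ \<tau>)"
proof -
  have x: "(0::real) \<in> {0..1}" by simp
  have "deriv_norm J f \<sigma> * deriv_norm J f \<tau>
      \<le> (distortion * \<bar>D \<sigma> (\<phi> \<tau> 0)\<bar>) * (distortion * \<bar>D \<tau> 0\<bar>)"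
    using deriv_norm_distortion[OF \<sigma> word_branch_in[OF \<tau> x]] deriv_norm_distortion[OF \<tau> x]
      deriv_norm_pos[OF \<tau>] distortion_ge_1 by (intro mult_mono) auto
  also have "\<dots> = distortion\<^sup>2 * \<bar>D (\<sigma> @ \<tau>) 0\<bar>"
    by (simp add: word_deriv_append abs_mult power2_eq_square)
  also have "\<dots> \<le> distortion\<^sup>2 * deriv_norm J f (\<sigma> @ \<tau>)"
    using deriv_norm_upper[OF words_append[OF \<sigma> \<tau>] x] by (intro mult_left_mono) auto
  finally show ?thesis .
qed

lemma deriv_norm_powr_append_le:
  assumes \<sigma>: "\<sigma> \<in> words N m" and \<tau>: "\<tau> \<in> words N n" and h: "0 \<le> h"
  shows "deriv_norm J f (\<sigma> @ \<tau>) powr h \<le> deriv_norm J f \<sigma> powr h * deriv_norm J f \<tau> powr h"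
  using deriv_norm_append_le[OF \<sigma> \<tau>] deriv_norm_pos[OF \<sigma>] deriv_norm_pos[OF \<tau>]
    deriv_norm_pos[OF words_append[OF \<sigma> \<tau>]] h
  by (simp add: powr_mono2 flip: powr_mult)

lemma deriv_norm_powr_append_ge:
  assumes \<sigma>: "\<sigma> \<in> words N m" and \<tau>: "\<tau> \<in> words N n" and h: "0 \<le> h"
  shows "deriv_norm J f \<sigma> powr h * deriv_norm J f \<tau> powr h
           \<le> (distortion\<^sup>2) powr h * deriv_norm J f (\<sigma> @ \<tau>) powr h"
  using deriv_norm_append_ge[OF \<sigma> \<tau>] deriv_norm_pos[OF \<sigma>] deriv_norm_pos[OF \<tau>]
    deriv_norm_pos[OF words_append[OF \<sigma> \<tau>]] h
  by (simp add: powr_mono2 flip: powr_mult)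

section \<open>Cylinders\<close>

lemma compact_cylinder: "\<sigma> \<in> words N n \<Longrightarrow> compact (cylinder J f \<sigma>)"
  unfolding cylinder_def
  using word_branch_derivative by (intro compact_continuous_image DERIV_continuous_on) auto

text \<open>
  The upper bound is the mean value inequality; the lower bound applies the mean value theorem to
  the images of the end points \<open>0\<close> and \<open>1\<close> and then bounded distortion.
\<close>
lemma diameter_cylinder:
  assumes \<sigma>: "\<sigma> \<in> words N n"
  shows "diameter (cylinder J f \<sigma>) \<le> deriv_norm J f \<sigma>"
    and "deriv_norm J f \<sigma> \<le> distortion * diameter (cylinder J f \<sigma>)"
proof -
  show "diameter (cylinder J f \<sigma>) \<le> deriv_norm J f \<sigma>"
  proof (rule diameter_le)
    fix u v assume "u \<in> cylinder J f \<sigma>" "v \<in> cylinder J f \<sigma>"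
    then obtain x y where xy: "x \<in> {0..1}" "y \<in> {0..1}" "u = \<phi> \<sigma> x" "v = \<phi> \<sigma> y"
      by (auto simp: cylinder_def)
    have "\<bar>u - v\<bar> \<le> deriv_norm J f \<sigma> * \<bar>x - y\<bar>"
      using word_branch_lipschitz[OF \<sigma> xy(1,2) deriv_norm_upper[OF \<sigma>]] xy by simp
    also have "\<dots> \<le> deriv_norm J f \<sigma> * 1"
      using deriv_norm_pos[OF \<sigma>] xy by (intro mult_left_mono) auto
    finally show "norm (u - v) \<le> deriv_norm J f \<sigma>" by simp
  qed (use deriv_norm_pos[OF \<sigma>] in simp)
  obtain z where z: "z \<in> {0..1}" "\<phi> \<sigma> 1 - \<phi> \<sigma> 0 = D \<sigma> z * (1 - 0)"
    using mvt_very_simple[of 0 1 "\<phi> \<sigma>" "\<lambda>x. (*) (D \<sigma> x)"] word_branch_derivative[OF \<sigma>]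
    by (auto simp: has_field_derivative_def)
  have "dist (\<phi> \<sigma> 1) (\<phi> \<sigma> 0) \<le> diameter (cylinder J f \<sigma>)"
    using compact_imp_bounded[OF compact_cylinder[OF \<sigma>]]
    by (intro diameter_bounded_bound) (auto simp: cylinder_def)
  then have "\<bar>D \<sigma> z\<bar> \<le> diameter (cylinder J f \<sigma>)"
    using z(2) by (simp add: dist_real_def)
  then show "deriv_norm J f \<sigma> \<le> distortion * diameter (cylinder J f \<sigma>)"
    using deriv_norm_distortion[OF \<sigma> z(1)] distortion_ge_1
    by (meson mult_left_mono order_trans zero_le_one)
qed

text \<open>
  If the first letters differ, the cylinders lie in different \<open>J j\<close>; otherwise they are images of
  disjoint cylinders under one injective branch.
\<close>
lemma disjoint_cylinders:
  "\<sigma> \<in> words N n \<Longrightarrow> \<tau> \<in> words N n \<Longrightarrow> \<sigma> \<noteq> \<tau> \<Longrightarrow> cylinder J f \<sigma> \<inter> cylinder J f \<tau> = {}"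
proof (induction n arbitrary: \<sigma> \<tau>)
  case 0
  then show ?case by (simp add: words_def)
next
  case (Suc n)
  obtain i \<sigma>' where \<sigma>: "\<sigma> = i # \<sigma>'" "i \<in> {1..N}" "\<sigma>' \<in> words N n"
    using Suc.prems(1) by (cases \<sigma>) (auto simp: words_def)
  obtain j \<tau>' where \<tau>: "\<tau> = j # \<tau>'" "j \<in> {1..N}" "\<tau>' \<in> words N n"
    using Suc.prems(2) by (cases \<tau>) (auto simp: words_def)
  have sub: "cylinder J f \<sigma>' \<subseteq> {0..1}" "cylinder J f \<tau>' \<subseteq> {0..1}"
    unfolding cylinder_def
    by (intro image_subsetI word_branch_in[OF \<sigma>(3)], assumption)
      (intro image_subsetI word_branch_in[OF \<tau>(3)], assumption)
  have im: "cylinder J f \<sigma> = branch J f i ` cylinder J f \<sigma>'"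
    "cylinder J f \<tau> = branch J f j ` cylinder J f \<tau>'"
    by (auto simp: cylinder_def \<sigma>(1) \<tau>(1) image_comp)
  show ?case
  proof (cases "i = j")
    case True
    then have "cylinder J f \<sigma>' \<inter> cylinder J f \<tau>' = {}"
      using Suc.IH[OF \<sigma>(3) \<tau>(3)] Suc.prems(3) \<sigma>(1) \<tau>(1) by blast
    then show ?thesis
      using inj_on_image_Int[OF inj_branch[OF \<sigma>(2)] sub] True unfolding im by simp
  next
    case False
    have "cylinder J f \<sigma> \<subseteq> J i"
      unfolding im by (intro image_subsetI branch_in[OF \<sigma>(2)]) (rule subsetD[OF sub(1)])
    moreover have "cylinder J f \<tau> \<subseteq> J j"
      unfolding im by (intro image_subsetI branch_in[OF \<tau>(2)]) (rule subsetD[OF sub(2)])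
    moreover have "J i \<inter> J j = {}"
      using disjoint_J False \<sigma>(2) \<tau>(2) unfolding disjoint_family_on_def by blast
    ultimately show ?thesis by blast
  qed
qed

sublocale compact_word_tree N "cylinder J f"
proof
  show "1 \<le> N" using two_le_N by simp
  show "cylinder J f (\<sigma> @ \<tau>) \<subseteq> cylinder J f \<sigma>" if "\<sigma> \<in> words N m" "\<tau> \<in> words N n" for \<sigma> \<tau> m n
    using word_branch_in[OF that(2)] by (auto simp: cylinder_def word_branch_append)
qed (use compact_cylinder disjoint_cylinders in \<open>auto simp: cylinder_def\<close>)

section \<open>Partition sums at zero pressure\<close>

text \<open>
  Quasi-multiplicativity makes the logarithms of the partition sums quasi-additive. This gives
  convergence of the sequence whose limit defines the pressure, so that \<open>pressure N J f h\<close> is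
  its actual growth rate, and with rate \<open>0\<close> the linear bound becomes a uniform bound.
\<close>
lemma partition_sum_bounds:
  assumes h: "0 < h" and p0: "pressure N J f h = 0"
  defines "C \<equiv> (distortion\<^sup>2) powr h"
  shows "(\<Sum>\<sigma>\<in>words N n. deriv_norm J f \<sigma> powr h) \<le> C"
    and "1 / C \<le> (\<Sum>\<sigma>\<in>words N n. deriv_norm J f \<sigma> powr h)"
proof -
  define w where "w \<sigma> = deriv_norm J f \<sigma> powr h" for \<sigma>
  define Z where "Z n = (\<Sum>\<sigma>\<in>words N n. w \<sigma>)" for n
  have C1: "1 \<le> C"
    unfolding C_def using distortion_ge_1 h by (intro ge_one_powr_ge_zero) auto
  have w_pos: "0 < w \<sigma>" if "\<sigma> \<in> words N n" for \<sigma> n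
    using deriv_norm_pos[OF that] by (simp add: w_def)
  have Z_pos: "0 < Z n" for n
    unfolding Z_def using words_nonempty[OF one_le_N] w_pos by (intro sum_pos) auto
  have prod: "Z m * Z n = (\<Sum>\<sigma>\<in>words N m. \<Sum>\<tau>\<in>words N n. w \<sigma> * w \<tau>)" for m n
    by (simp add: Z_def sum_product)
  have up: "Z (m + n) \<le> Z m * Z n" for m n
    unfolding prod unfolding Z_def sum_words_add
    unfolding w_def using h by (intro sum_mono deriv_norm_powr_append_le) auto
  have low: "Z m * Z n \<le> C * Z (m + n)" for m n
    unfolding prod unfolding Z_def sum_words_add sum_distrib_left
    unfolding w_def C_def using h by (intro sum_mono deriv_norm_powr_append_ge) auto
  have qa: "\<bar>ln (Z (m + n)) - ln (Z m) - ln (Z n)\<bar> \<le> ln C" for m n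
  proof -
    have "ln (Z (m + n)) \<le> ln (Z m * Z n)"
      using up[of m n] Z_pos by simp
    moreover have "ln (Z m * Z n) \<le> ln (C * Z (m + n))"
      using low[of m n] Z_pos C1 by (subst ln_le_cancel_iff) auto
    ultimately show ?thesis
      using Z_pos[of m] Z_pos[of n] Z_pos[of "m + n"] C1 by (simp add: ln_mult)
  qed
  obtain L where L: "(\<lambda>k. 1 / real k * ln (Z k)) \<longlonglongrightarrow> L"
    "\<And>k. \<bar>ln (Z k) - real k * L\<bar> \<le> ln C"
    using quasi_additive_linear[of "\<lambda>k. ln (Z k)", OF qa] by blast
  have "L = 0"
    using limI[OF L(1)] p0 by (simp add: pressure_def Z_def w_def)
  then have bd: "ln (Z n) \<le> ln C" "ln (1 / C) \<le> ln (Z n)"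
    using L(2)[of n] C1 by (auto simp: ln_div)
  show "(\<Sum>\<sigma>\<in>words N n. deriv_norm J f \<sigma> powr h) \<le> C"
    using bd(1) Z_pos[of n] C1 by (simp add: Z_def w_def)
  show "1 / C \<le> (\<Sum>\<sigma>\<in>words N n. deriv_norm J f \<sigma> powr h)"
    using bd(2) Z_pos[of n] C1 by (subst (asm) ln_le_cancel_iff) (auto simp: Z_def w_def)
qed

end

section \<open>The Gibbs measure on the cookie-cutter set\<close>

theorem proposition2p12:
  fixes N :: nat and J :: "nat \<Rightarrow> real set" and f :: "real \<Rightarrow> real" and h :: real
  assumes "cookie_cutter N J f"
    and "0 < h"
    and "pressure N J f h = 0"
  shows "\<exists>\<eta>>1. \<exists>\<mu>::real measure.
           prob_space \<mu> \<and> sets \<mu> = sets borel \<and>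
           cookie_cutter_set N J f \<in> sets \<mu> \<and> emeasure \<mu> (cookie_cutter_set N J f) = 1 \<and>
           (\<forall>\<sigma>\<in>all_words N.
              inverse \<eta> * diameter (cylinder J f \<sigma>) powr h \<le> measure \<mu> (cylinder J f \<sigma>) \<and>
              measure \<mu> (cylinder J f \<sigma>) \<le> \<eta> * diameter (cylinder J f \<sigma>) powr h)"
proof -
  obtain c \<gamma> b where "cookie_cutter_map N J f c \<gamma> b"
    using cookie_cutter_imp_map[OF assms(1)] .
  then interpret cookie_cutter_map N J f c \<gamma> b .
  define w where "w \<sigma> = deriv_norm J f \<sigma> powr h" for \<sigma>
  define C where "C = (distortion\<^sup>2) powr h"
  have C1: "1 \<le> C"
    unfolding C_def using distortion_ge_1 assms(2) by (intro ge_one_powr_ge_zero) auto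
  have w_pos: "0 < w \<sigma>" if "\<sigma> \<in> words N n" for \<sigma> n
    using deriv_norm_pos[OF that] by (simp add: w_def)
  have "\<exists>\<mu>. real_distribution \<mu> \<and> (\<forall>n. AE x in \<mu>. x \<in> level n) \<and>
      (\<forall>n. \<forall>\<sigma>\<in>words N n. w \<sigma> / C ^ 3 \<le> measure \<mu> (cylinder J f \<sigma>) \<and>
         measure \<mu> (cylinder J f \<sigma>) \<le> C ^ 3 * w \<sigma>)"
  proof (rule gibbs_measure_exists)
    fix m n \<sigma> \<tau> assume \<sigma>: "\<sigma> \<in> words N m" and \<tau>: "\<tau> \<in> words N n"
    have "w (\<sigma> @ \<tau>) \<le> w \<sigma> * w \<tau>"
      unfolding w_def using assms(2) by (intro deriv_norm_powr_append_le[OF \<sigma> \<tau>]) simp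
    also have "\<dots> \<le> C * (w \<sigma> * w \<tau>)"
      using mult_right_mono[OF C1, of "w \<sigma> * w \<tau>"] w_pos[OF \<sigma>] w_pos[OF \<tau>] by simp
    finally show "w (\<sigma> @ \<tau>) \<le> C * (w \<sigma> * w \<tau>)" .
    show "w \<sigma> * w \<tau> \<le> C * w (\<sigma> @ \<tau>)"
      unfolding w_def C_def using assms(2) by (intro deriv_norm_powr_append_ge[OF \<sigma> \<tau>]) simp
  qed (use w_pos C1 partition_sum_bounds[OF assms(2,3)] in \<open>auto simp: w_def C_def\<close>)
  then obtain \<mu> where \<mu>: "real_distribution \<mu>" "\<And>n. AE x in \<mu>. x \<in> level n"
    and gibbs: "\<And>n \<sigma>. \<sigma> \<in> words N n \<Longrightarrow> w \<sigma> / C ^ 3 \<le> measure \<mu> (cylinder J f \<sigma>)"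
      "\<And>n \<sigma>. \<sigma> \<in> words N n \<Longrightarrow> measure \<mu> (cylinder J f \<sigma>) \<le> C ^ 3 * w \<sigma>"
    by blast
  interpret \<mu>: real_distribution \<mu> by (rule \<mu>(1))
  let ?E = "cookie_cutter_set N J f"
  have E: "?E = (\<Inter>n. level n)"
    unfolding cookie_cutter_set_def by (rule limit_set_eq_Inter_level)
  have E_sets: "?E \<in> sets \<mu>"
    unfolding E using borel_compact[OF compact_level] by (auto intro!: sets.countable_INT)
  have "AE x in \<mu>. x \<in> ?E"
    unfolding E using \<mu>(2) by (simp add: AE_all_countable)
  then have E_full: "emeasure \<mu> ?E = 1"
    using E_sets by (simp add: \<mu>.emeasure_eq_1_AE)
  define \<eta> where "\<eta> = C ^ 3 * distortion powr h + 1"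
  have dh1: "1 \<le> distortion powr h"
    using distortion_ge_1 assms(2) by (intro ge_one_powr_ge_zero) auto
  have C31: "1 \<le> C ^ 3" using C1 by (rule one_le_power)
  have "C ^ 3 * 1 \<le> C ^ 3 * distortion powr h"
    using C1 dh1 by (intro mult_left_mono) auto
  then have \<eta>1: "1 < \<eta>" "C ^ 3 \<le> \<eta>"
    unfolding \<eta>_def using C31 by linarith+
  have bounds: "inverse \<eta> * diameter (cylinder J f \<sigma>) powr h \<le> measure \<mu> (cylinder J f \<sigma>) \<and>
      measure \<mu> (cylinder J f \<sigma>) \<le> \<eta> * diameter (cylinder J f \<sigma>) powr h"
    if "\<sigma> \<in> all_words N" for \<sigma>
  proof -
    from that obtain n where \<sigma>: "\<sigma> \<in> words N n" by (auto simp: all_words_def)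
    let ?d = "diameter (cylinder J f \<sigma>)"
    have d0: "0 \<le> ?d"
      using compact_imp_bounded[OF compact_cylinder[OF \<sigma>]] by (rule diameter_ge_0)
    have "?d powr h \<le> w \<sigma>"
      unfolding w_def using diameter_cylinder(1)[OF \<sigma>] d0 assms(2) by (intro powr_mono2) auto
    then have "inverse \<eta> * ?d powr h \<le> inverse (C ^ 3) * w \<sigma>"
      using \<eta>1 C1 by (intro mult_mono le_imp_inverse_le) auto
    also have "\<dots> \<le> measure \<mu> (cylinder J f \<sigma>)"
      using gibbs(1)[OF \<sigma>] by (simp add: field_simps)
    finally have low: "inverse \<eta> * ?d powr h \<le> measure \<mu> (cylinder J f \<sigma>)" .
    have "w \<sigma> \<le> (distortion * ?d) powr h"
      unfolding w_def using diameter_cylinder(2)[OF \<sigma>] deriv_norm_pos[OF \<sigma>] assms(2)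
      by (intro powr_mono2) auto
    also have "\<dots> = distortion powr h * ?d powr h"
      using d0 distortion_ge_1 by (simp add: powr_mult)
    finally have "C ^ 3 * w \<sigma> \<le> C ^ 3 * distortion powr h * ?d powr h"
      using C1 by (simp add: mult.assoc)
    also have "\<dots> \<le> \<eta> * ?d powr h"
      unfolding \<eta>_def by (intro mult_right_mono) auto
    finally show ?thesis using low gibbs(2)[OF \<sigma>] by simp
  qed
  show ?thesis
    using \<eta>1(1) \<mu>.prob_space_axioms E_sets E_full bounds by (intro exI[of _ \<eta>] exI[of _ \<mu>]) auto
qed

end
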